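(* For every fixed integer $k\ge 3$ there is a family of unsatisfiable 3-CNF formulas $\{\Gamma_n^k\}_{n=1}^\infty$ with $O(n)$ variables, $O(n^2)$ clauses and minimal refutation width $k$ such that the following holds: (1) every width-$k$ resolution refutation of $\Gamma_n^k$ has length at least $\Omega(n^{k-1})$; (2) there is a width-$(k+1)$ treelike resolution refutation of $\Gamma_n^k$ of length $O(1)$.
   Context: Asymptotics are in $n$ for fixed $k$; the implied constants may depend on $k$. A literal is a Boolean variable $X$ or its negation $\neg X$. A clause is a set of literals (read as a disjunction); its width is the number of literals in it. A 3-CNF formula is a finite set of clauses of width at most $3$. The resolution rule on $X$ takes clauses $\gamma\cup\{X\}$ and $\delta\cup\{\neg X\}$ and derives the resolvent $\gamma\cup\delta$. A resolution refutation of $\Gamma$ is a sequence of clauses ending in the empty clause in which each clause is in $\Gamma$ or is a resolvent of two preceding clauses. Its length is the number of clauses it contains; its width is the maximum width of the clauses in it. The minimal refutation width of $\Gamma$ is the smallest width of a resolution refutation of $\Gamma$. A width-$k$ refutation is a refutation of width at most $k$. A refutation is treelike if its associated directed acyclic graph (with an arc from each resolvent to each of the two clauses it was derived from) is a tree, i.e. each derived occurrence of a clause is used at most once as a premise (clauses may be repeated). *)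

theory Defs
  imports Complex_Main "HOL-Library.Landau_Symbols"
begin

datatype 'v lit = Pos 'v | Neg 'v

type_synonym 'v clause = "'v lit set"

primrec lit_var :: "'v lit \<Rightarrow> 'v" where
  "lit_var (Pos X) = X"
| "lit_var (Neg X) = X"

primrec lit_true :: "('v \<Rightarrow> bool) \<Rightarrow> 'v lit \<Rightarrow> bool" where
  "lit_true \<alpha> (Pos X) = \<alpha> X"
| "lit_true \<alpha> (Neg X) = (\<not> \<alpha> X)"

definition clause_width :: "'v clause \<Rightarrow> nat" where
  "clause_width C = card C"

definition three_cnf :: "'v clause set \<Rightarrow> bool" where
  "three_cnf \<Gamma> \<longleftrightarrow> finite \<Gamma> \<and> (\<forall>C\<in>\<Gamma>. finite C \<and> clause_width C \<le> 3)"

definition cnf_vars :: "'v clause set \<Rightarrow> 'v set" where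
  "cnf_vars \<Gamma> = (\<Union>C\<in>\<Gamma>. lit_var ` C)"

definition unsatisfiable :: "'v clause set \<Rightarrow> bool" where
  "unsatisfiable \<Gamma> \<longleftrightarrow> \<not> (\<exists>\<alpha>. \<forall>C\<in>\<Gamma>. \<exists>l\<in>C. lit_true \<alpha> l)"

text \<open>The side clauses \<open>\<gamma>\<close> and \<open>\<delta>\<close> may themselves contain the literal resolved upon,
  and clauses may be tautological.\<close>

definition is_resolvent :: "'v clause \<Rightarrow> 'v clause \<Rightarrow> 'v clause \<Rightarrow> bool" where
  "is_resolvent C D E \<longleftrightarrow>
     (\<exists>X \<gamma> \<delta>. C = \<gamma> \<union> {Pos X} \<and> D = \<delta> \<union> {Neg X} \<and> E = \<gamma> \<union> \<delta>)"

text \<open>The length of a refutation is the length of the list.\<close>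

definition refutation :: "'v clause set \<Rightarrow> 'v clause list \<Rightarrow> bool" where
  "refutation \<Gamma> \<pi> \<longleftrightarrow> \<pi> \<noteq> [] \<and> last \<pi> = {} \<and>
     (\<forall>i<length \<pi>. \<pi> ! i \<in> \<Gamma> \<or> (\<exists>j<i. \<exists>l<i. is_resolvent (\<pi> ! j) (\<pi> ! l) (\<pi> ! i)))"

definition refutation_width :: "'v clause list \<Rightarrow> nat" where
  "refutation_width \<pi> = Max (clause_width ` set \<pi>)"

text \<open>This is meaningful only if \<open>\<Gamma>\<close> has a refutation.\<close>

definition min_refutation_width :: "'v clause set \<Rightarrow> nat" where
  "min_refutation_width \<Gamma> = (LEAST w. \<exists>\<pi>. refutation \<Gamma> \<pi> \<and> refutation_width \<pi> = w)"

text \<open>A sequence of clauses need not determine which premises a clause was derived from, so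
  the associated graph is given by an annotation \<open>J\<close>: position \<open>i\<close> is an initial clause
  if \<open>J i = None\<close>, and was derived from positions \<open>j\<close> and \<open>l\<close> if \<open>J i = Some (j, l)\<close>.\<close>

definition justifies ::
  "'v clause set \<Rightarrow> 'v clause list \<Rightarrow> (nat \<Rightarrow> (nat \<times> nat) option) \<Rightarrow> bool" where
  "justifies \<Gamma> \<pi> J \<longleftrightarrow> (\<forall>i<length \<pi>.
     (case J i of
        None \<Rightarrow> \<pi> ! i \<in> \<Gamma>
      | Some (j, l) \<Rightarrow> j < i \<and> l < i \<and> is_resolvent (\<pi> ! j) (\<pi> ! l) (\<pi> ! i)))"

definition dag_arcs :: "nat \<Rightarrow> (nat \<Rightarrow> (nat \<times> nat) option) \<Rightarrow> (nat \<times> nat) set" where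
  "dag_arcs N J = {(m, i). m < N \<and> (\<exists>j l. J m = Some (j, l) \<and> i \<in> {j, l})}"

text \<open>The arcs go from later to earlier positions, so the graph is a tree rooted at the last
  position iff every other position has exactly one incoming arc. Using one occurrence for both
  premises of a step would give a double arc, which is excluded separately. Positions, not
  clauses, are the vertices: a clause may be repeated.\<close>

definition dag_is_tree :: "nat \<Rightarrow> (nat \<Rightarrow> (nat \<times> nat) option) \<Rightarrow> bool" where
  "dag_is_tree N J \<longleftrightarrow>
     (\<forall>m<N. \<forall>j l. J m = Some (j, l) \<longrightarrow> j \<noteq> l) \<and>
     (\<forall>i. Suc i < N \<longrightarrow> (\<exists>!m. (m, i) \<in> dag_arcs N J))"

definition treelike_refutation :: "'v clause set \<Rightarrow> 'v clause list \<Rightarrow> bool" where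
  "treelike_refutation \<Gamma> \<pi> \<longleftrightarrow>
     refutation \<Gamma> \<pi> \<and> (\<exists>J. justifies \<Gamma> \<pi> J \<and> dag_is_tree (length \<pi>) J)"

end

theory Submission
  imports Defs "HOL-Library.Nat_Bijection" "HOL-Library.FuncSet"
begin

text \<open>Take the pigeonhole principle with \<open>K + 1\<close> pigeons and \<open>K\<close> holes and give every pigeon, besides
  its hole, one of \<open>n\<close> labels. The long clauses are split in ladder form; the ladder runs through all
  holes for one label before moving on to the next, so that its literals carry labels too. Fixing the labels \<open>t\<close> of the pigeons leaves a copy of the pigeonhole
  principle, so a refutation contains for each \<open>t\<close> a clause which mentions \<open>K\<close> pigeons together
  with their labels under \<open>t\<close>. A clause of bounded width does this for only \<open>O(n)\<close> of the
  \<open>n ^ (K + 1)\<close> choices of \<open>t\<close>, hence the length is \<open>\<Omega>(n ^ K)\<close>. The minimal width is exactly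
  \<open>K + 1\<close> as soon as there are two labels.

  The formula for \<open>k\<close> is the disjoint union of the growing instance with \<open>K = k - 1\<close> and the constant
  instance with \<open>K = k\<close> and two labels: refutations do not mix the two parts, so width \<open>k\<close> has to
  refute the first one, while width \<open>k + 1\<close> can refute the second one in constant length.\<close>

section \<open>Derivations within a set of clauses\<close>

text \<open>Order and repetition of clauses are forgotten; only the set \<open>S\<close> that they
  are taken from remains. With \<open>S\<close> the clauses of a refutation this serves for length,
  with \<open>S = narrow w\<close> for width.\<close>

inductive deriv :: "'v clause set \<Rightarrow> 'v clause set \<Rightarrow> 'v clause \<Rightarrow> bool" for \<Gamma> S where
  axiom: "C \<in> \<Gamma> \<Longrightarrow> C \<in> S \<Longrightarrow> deriv \<Gamma> S C"
| resolve: "deriv \<Gamma> S C \<Longrightarrow> deriv \<Gamma> S D \<Longrightarrow> is_resolvent C D E \<Longrightarrow> E \<in> S \<Longrightarrow> deriv \<Gamma> S E"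

abbreviation sat :: "('v \<Rightarrow> bool) \<Rightarrow> 'v clause \<Rightarrow> bool" where
  "sat \<alpha> C \<equiv> \<exists>l\<in>C. lit_true \<alpha> l"

text \<open>Finiteness is demanded because \<open>card\<close> of an infinite clause is 0.\<close>

definition narrow :: "nat \<Rightarrow> 'v clause set" where
  "narrow w = {C. finite C \<and> card C \<le> w}"

lemma narrow_mono: "m \<le> w \<Longrightarrow> narrow m \<subseteq> narrow w"
  by (auto simp: narrow_def)

lemma is_resolventE:
  assumes "is_resolvent C D E"
  obtains X \<gamma> \<delta> where "C = insert (Pos X) \<gamma>" "D = insert (Neg X) \<delta>" "E = \<gamma> \<union> \<delta>"
  using assms unfolding is_resolvent_def by auto

lemma resolvent_sat:
  "is_resolvent C D E \<Longrightarrow> sat \<alpha> C \<Longrightarrow> sat \<alpha> D \<Longrightarrow> sat \<alpha> E"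
  by (auto elim!: is_resolventE)

lemma deriv_sat: "deriv \<Gamma> S C \<Longrightarrow> (\<And>C. C \<in> \<Gamma> \<Longrightarrow> sat \<alpha> C) \<Longrightarrow> sat \<alpha> C"
proof (induction rule: deriv.induct)
  case (resolve C D E)
  then show ?case by (intro resolvent_sat[OF resolve.hyps(3)]) auto
qed auto

lemma deriv_mono: "deriv \<Gamma> S C \<Longrightarrow> \<Gamma> \<subseteq> \<Gamma>' \<Longrightarrow> S \<subseteq> S' \<Longrightarrow> deriv \<Gamma>' S' C"
  by (induction rule: deriv.induct) (auto intro: deriv.intros)

lemma deriv_in: "deriv \<Gamma> S C \<Longrightarrow> C \<in> S"
  by (induction rule: deriv.induct) auto

lemma deriv_vars: "deriv \<Gamma> S C \<Longrightarrow> lit_var ` C \<subseteq> cnf_vars \<Gamma>"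
  by (induction rule: deriv.induct) (auto simp: cnf_vars_def elim!: is_resolventE)

text \<open>A list may contain infinite clauses, which count as width 0. Resolvents of finite
  clauses are finite, so a derivation from finite clauses never reaches them.\<close>

lemma deriv_finite:
  "deriv \<Gamma> S C \<Longrightarrow> (\<And>C. C \<in> \<Gamma> \<Longrightarrow> finite C) \<Longrightarrow> deriv \<Gamma> {C \<in> S. finite C} C"
proof (induction rule: deriv.induct)
  case (axiom C)
  then show ?case by (intro deriv.axiom) auto
next
  case (resolve C D E)
  have CD: "deriv \<Gamma> {C \<in> S. finite C} C" "deriv \<Gamma> {C \<in> S. finite C} D"
    using resolve by auto
  then have "finite C" "finite D" using deriv_in by blast+
  then have "finite E" using resolve.hyps(3) by (auto elim!: is_resolventE)
  then show ?case using CD resolve.hyps by (auto intro: deriv.resolve)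
qed

lemma refutation_deriv:
  assumes "refutation \<Gamma> \<pi>"
  shows "deriv \<Gamma> (set \<pi>) {}"
proof -
  have "i < length \<pi> \<Longrightarrow> deriv \<Gamma> (set \<pi>) (\<pi> ! i)" for i
  proof (induction i rule: less_induct)
    case (less i)
    have "\<pi> ! i \<in> \<Gamma> \<or> (\<exists>j<i. \<exists>l<i. is_resolvent (\<pi> ! j) (\<pi> ! l) (\<pi> ! i))"
      using assms less.prems by (auto simp: refutation_def)
    then show ?case
    proof (elim disjE exE conjE)
      assume "\<pi> ! i \<in> \<Gamma>"
      then show ?thesis using less.prems by (intro deriv.axiom) auto
    next
      fix j l assume jl: "j < i" "l < i" "is_resolvent (\<pi> ! j) (\<pi> ! l) (\<pi> ! i)"
      have "deriv \<Gamma> (set \<pi>) (\<pi> ! j)" "deriv \<Gamma> (set \<pi>) (\<pi> ! l)"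
        using less jl by simp_all
      then show ?thesis using jl(3) by (rule deriv.resolve) (use less.prems in simp)
    qed
  qed
  moreover have "\<pi> \<noteq> []" "\<pi> ! (length \<pi> - 1) = {}"
    using assms by (auto simp: refutation_def last_conv_nth)
  ultimately show ?thesis by (metis diff_less length_greater_0_conv zero_less_one)
qed

text \<open>Resolving on a variable requires that it occurs in both premises, so clauses over
  disjoint sets of variables never interact.\<close>

lemma deriv_disjoint_union:
  assumes "deriv (A \<union> B) S C" "cnf_vars A \<inter> cnf_vars B = {}"
  shows "deriv A S C \<or> deriv B S C"
  using assms
proof (induction rule: deriv.induct)
  case (axiom C)
  then show ?case by (auto intro: deriv.axiom)
next
  case (resolve C D E)
  obtain X \<gamma> \<delta> where "C = insert (Pos X) \<gamma>" "D = insert (Neg X) \<delta>"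
    using resolve.hyps(3) by (rule is_resolventE)
  then have "X \<in> lit_var ` C" "X \<in> lit_var ` D" by auto
  then have "\<not> (deriv A S C \<and> deriv B S D)" "\<not> (deriv B S C \<and> deriv A S D)"
    using resolve.prems deriv_vars by blast+
  then show ?case using resolve by (auto intro: deriv.resolve)
qed

section \<open>Unfolding a derivation into a tree\<close>

text \<open>Every use of a premise gets its own copy: the lists for \<open>C\<close> and
  \<open>D\<close> are put one after the other and \<open>E\<close> is appended. The length may
  explode, which is harmless for a fixed formula.\<close>

lemma tree_unfold:
  assumes "deriv \<Gamma> S C"
  shows "\<exists>\<pi> J. \<pi> \<noteq> [] \<and> last \<pi> = C \<and> set \<pi> \<subseteq> S \<and> justifies \<Gamma> \<pi> J \<and> dag_is_tree (length \<pi>) J"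
  using assms
proof (induction rule: deriv.induct)
  case (axiom C)
  then show ?case
    by (intro exI[of _ "[C]"] exI[of _ "\<lambda>_. None"]) (auto simp: justifies_def dag_is_tree_def)
next
  case (resolve C D E)
  obtain p J where p: "p \<noteq> []" "last p = C" "set p \<subseteq> S" "justifies \<Gamma> p J"
    "dag_is_tree (length p) J" using resolve.IH(1) by blast
  obtain q K where q: "q \<noteq> []" "last q = D" "set q \<subseteq> S" "justifies \<Gamma> q K"
    "dag_is_tree (length q) K" using resolve.IH(2) by blast
  define a where "a = length p"
  define b where "b = length q"
  have ab: "a > 0" "b > 0" using p q by (auto simp: a_def b_def)
  define r where "r = p @ q @ [E]"
  \<comment> \<open>The second block is shifted by \<open>a\<close>; the new root points to the last
    positions of the two blocks, \<open>a - 1\<close> and \<open>a + b - 1\<close>.\<close>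
  define M where "M i = (if i < a then J i
      else if i < a + b then map_option (\<lambda>(j, l). (j + a, l + a)) (K (i - a))
      else Some (a - 1, a + b - 1))" for i
  have len: "length r = Suc (a + b)" by (simp add: r_def a_def b_def)
  have r1: "r ! i = p ! i" if "i < a" for i using that by (simp add: r_def a_def nth_append)
  have r2: "r ! (i + a) = q ! i" if "i < b" for i
    using that by (simp add: r_def a_def b_def nth_append)
  have r3: "r ! (a + b) = E" by (simp add: r_def a_def b_def nth_append)
  have Jlt: "j < i \<and> l < i" if "J i = Some (j, l)" "i < a" for i j l
    using p(4) that by (auto simp: justifies_def a_def dest!: spec[of _ i])
  have Klt: "j < i \<and> l < i" if "K i = Some (j, l)" "i < b" for i j l
    using q(4) that by (auto simp: justifies_def b_def dest!: spec[of _ i])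
  have cases: "i < a \<or> (\<exists>i'<b. i = i' + a) \<or> i = a + b" if "i < Suc (a + b)" for i
    using that by (cases "i < a"; cases "i < a + b") (auto intro!: exI[of _ "i - a"])
  have "justifies \<Gamma> r M"
    unfolding justifies_def
  proof (intro allI impI)
    fix i assume "i < length r"
    then consider "i < a" | i' where "i' < b" "i = i' + a" | "i = a + b"
      using cases len by auto
    then show "case M i of None \<Rightarrow> r ! i \<in> \<Gamma>
      | Some (j, l) \<Rightarrow> j < i \<and> l < i \<and> is_resolvent (r ! j) (r ! l) (r ! i)"
    proof cases
      case 1
      have "case J i of None \<Rightarrow> p ! i \<in> \<Gamma>
        | Some (j, l) \<Rightarrow> j < i \<and> l < i \<and> is_resolvent (p ! j) (p ! l) (p ! i)"
        using p(4) 1 by (auto simp: justifies_def a_def)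
      then show ?thesis using 1 by (auto simp: M_def r1 split: option.splits)
    next
      case 2
      have "case K i' of None \<Rightarrow> q ! i' \<in> \<Gamma>
        | Some (j, l) \<Rightarrow> j < i' \<and> l < i' \<and> is_resolvent (q ! j) (q ! l) (q ! i')"
        using q(4) 2 by (auto simp: justifies_def b_def)
      then show ?thesis using 2 by (auto simp: M_def r2 split: option.splits)
    next
      case 3
      have "r ! (a - 1) = C" using p ab by (simp add: r1) (simp add: a_def last_conv_nth)
      moreover have "r ! (a + b - 1) = D"
      proof -
        have "a + b - 1 = (b - 1) + a" using ab by simp
        then have "r ! (a + b - 1) = q ! (b - 1)" using ab r2[of "b - 1"] by simp
        then show ?thesis using q by (simp add: b_def last_conv_nth)
      qed
      ultimately show ?thesis using 3 ab resolve.hyps(3) by (auto simp: M_def r3)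
    qed
  qed
  moreover have "dag_is_tree (length r) M"
    unfolding dag_is_tree_def
  proof (intro conjI allI impI)
    fix m j l assume m: "m < length r" "M m = Some (j, l)"
    then consider "m < a" | m' where "m' < b" "m = m' + a" | "m = a + b"
      using cases len by auto
    then show "j \<noteq> l"
      using m p(5)[folded a_def] q(5)[folded b_def] ab
      by cases (auto simp: M_def dag_is_tree_def)
  next
    fix i assume i: "Suc i < length r"
    have arcs: "(m, i) \<in> dag_arcs (length r) M \<longleftrightarrow>
        (m < a \<and> (m, i) \<in> dag_arcs a J) \<or>
        (\<exists>m'<b. \<exists>i'. m = m' + a \<and> i = i' + a \<and> (m', i') \<in> dag_arcs b K) \<or>
        (m = a + b \<and> (i = a - 1 \<or> i = a + b - 1))" for m
    proof (cases "m < Suc (a + b)")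
      case True
      then consider "m < a" | m' where "m' < b" "m = m' + a" | "m = a + b"
        using cases by auto
      then show ?thesis
      proof cases
        case 2
        then show ?thesis
          unfolding dag_arcs_def len by (auto simp: M_def)
      qed (auto simp: dag_arcs_def M_def len)
    qed (auto simp: dag_arcs_def len)
    have Jb: "m < a \<and> x < m" if "(m, x) \<in> dag_arcs a J" for m x
      using that Jlt by (auto simp: dag_arcs_def)
    have Kb: "m < b \<and> x < m" if "(m, x) \<in> dag_arcs b K" for m x
      using that Klt by (auto simp: dag_arcs_def)
    \<comment> \<open>A position is a non-root or the root of one of the two blocks. Arcs go to
      smaller positions, so a root has no incoming arc within its block and gets exactly one, from
      \<open>a + b\<close>.\<close>
    consider "Suc i < a" | "Suc i = a" | i' where "i = i' + a" "Suc i' < b"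
      | "Suc i = a + b" "i \<ge> a"
    proof (cases "i < a")
      case False
      then show ?thesis using i len that(3)[of "i - a"] that(4) by (cases "Suc i = a + b") auto
    qed (use that in linarith)
    then show "\<exists>!m. (m, i) \<in> dag_arcs (length r) M"
    proof cases
      case 1
      then have "\<exists>!m. (m, i) \<in> dag_arcs a J" using p(5) by (auto simp: dag_is_tree_def a_def)
      then show ?thesis using 1 Jb unfolding arcs by auto
    next
      case 2
      then show ?thesis unfolding arcs using Jb Kb ab
        by (intro ex1I[of _ "a + b"]) (fastforce)+
    next
      case 3
      then have "\<exists>!m. (m, i') \<in> dag_arcs b K" using q(5) by (auto simp: dag_is_tree_def b_def)
      then obtain m where m: "(m, i') \<in> dag_arcs b K" "\<And>m'. (m', i') \<in> dag_arcs b K \<Longrightarrow> m' = m"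
        by blast
      show ?thesis unfolding arcs
      proof (intro ex1I[of _ "m + a"])
        fix x assume x: "(x < a \<and> (x, i) \<in> dag_arcs a J) \<or>
          (\<exists>m'<b. \<exists>i'. x = m' + a \<and> i = i' + a \<and> (m', i') \<in> dag_arcs b K) \<or>
          (x = a + b \<and> (i = a - 1 \<or> i = a + b - 1))"
        then show "x = m + a" using 3 m(2) ab by (auto dest: Jb)
      qed (use m(1) Kb[OF m(1)] 3 in auto)
    next
      case 4
      then show ?thesis unfolding arcs using Jb Kb ab
        by (intro ex1I[of _ "a + b"]) (fastforce)+
    qed
  qed
  moreover have "r \<noteq> []" "last r = E" "set r \<subseteq> S"
    using p q resolve.hyps by (auto simp: r_def)
  ultimately show ?case by blast
qed

lemma deriv_treelike:
  assumes "deriv \<Gamma> (narrow w) {}"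
  shows "\<exists>\<pi>. treelike_refutation \<Gamma> \<pi> \<and> refutation_width \<pi> \<le> w"
proof -
  obtain \<pi> J where \<pi>: "\<pi> \<noteq> []" "last \<pi> = {}" "set \<pi> \<subseteq> narrow w" "justifies \<Gamma> \<pi> J"
    "dag_is_tree (length \<pi>) J" using tree_unfold[OF assms] by blast
  have "refutation \<Gamma> \<pi>"
    unfolding refutation_def
  proof (intro conjI allI impI)
    fix i assume "i < length \<pi>"
    then have "case J i of None \<Rightarrow> \<pi> ! i \<in> \<Gamma>
        | Some (j, l) \<Rightarrow> j < i \<and> l < i \<and> is_resolvent (\<pi> ! j) (\<pi> ! l) (\<pi> ! i)"
      using \<pi> by (auto simp: justifies_def)
    then show "\<pi> ! i \<in> \<Gamma> \<or> (\<exists>j<i. \<exists>l<i. is_resolvent (\<pi> ! j) (\<pi> ! l) (\<pi> ! i))"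
      by (cases "J i") auto
  qed (use \<pi> in auto)
  moreover have "refutation_width \<pi> \<le> w"
    using \<pi> by (auto simp: refutation_width_def clause_width_def narrow_def)
  ultimately show ?thesis using \<pi> unfolding treelike_refutation_def by blast
qed

section \<open>The pigeonhole principle with labels\<close>

text \<open>The parity of the second component separates the two kinds of variables. Thus every
  natural number is a variable of one kind, and \<open>pigeon\<close> and \<open>pos\<close> decode
  both alike.\<close>

definition at_pos :: "nat \<Rightarrow> nat \<Rightarrow> nat" where "at_pos v i = prod_encode (v, 2 * i)"
definition ge_pos :: "nat \<Rightarrow> nat \<Rightarrow> nat" where "ge_pos v i = prod_encode (v, Suc (2 * i))"

definition pigeon :: "nat \<Rightarrow> nat" where "pigeon X = fst (prod_decode X)"
definition pos :: "nat \<Rightarrow> nat" where "pos X = snd (prod_decode X) div 2"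

text \<open>Such an assignment makes all \<open>start\<close> and \<open>step\<close> clauses true,
  and the \<open>stop\<close> clause of \<open>v\<close> if \<open>f v < K * n\<close>. Only
  \<open>hole\<close> clauses can then fail.\<close>

definition placement :: "(nat \<Rightarrow> nat) \<Rightarrow> nat \<Rightarrow> bool" where
  "placement f X = (if even (snd (prod_decode X)) then f (pigeon X) = pos X
     else pos X \<le> f (pigeon X))"

text \<open>Pigeon \<open>v\<close> occupies one of \<open>K * n\<close> positions; position \<open>i\<close> lies in hole \<open>i mod K\<close> and
  carries the label \<open>i div K\<close>. The variable \<open>at_pos v i\<close> says that \<open>v\<close> is at position \<open>i\<close>, and
  \<open>ge_pos v i\<close> that it is at position \<open>i\<close> or later.\<close>

inductive_set php :: "nat set \<Rightarrow> nat \<Rightarrow> nat \<Rightarrow> nat clause set" for V K n where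
  start: "v \<in> V \<Longrightarrow> {Pos (ge_pos v 0)} \<in> php V K n"
| stop: "v \<in> V \<Longrightarrow> {Neg (ge_pos v (K * n))} \<in> php V K n"
| step: "v \<in> V \<Longrightarrow> i < K * n \<Longrightarrow> {Neg (ge_pos v i), Pos (at_pos v i), Pos (ge_pos v (Suc i))} \<in> php V K n"
| hole: "u \<in> V \<Longrightarrow> v \<in> V \<Longrightarrow> u \<noteq> v \<Longrightarrow> i < K * n \<Longrightarrow> j < K * n \<Longrightarrow> i mod K = j mod K \<Longrightarrow>
    {Neg (at_pos u i), Neg (at_pos v j)} \<in> php V K n"

lemma pigeon_simps [simp]: "pigeon (at_pos v i) = v" "pigeon (ge_pos v i) = v"
  by (simp_all add: pigeon_def at_pos_def ge_pos_def)

lemma pos_simps [simp]: "pos (at_pos v i) = i" "pos (ge_pos v i) = i"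
  by (simp_all add: pos_def at_pos_def ge_pos_def)

lemma placement_simps [simp]:
  "placement f (at_pos v i) \<longleftrightarrow> f v = i" "placement f (ge_pos v i) \<longleftrightarrow> i \<le> f v"
  by (auto simp: placement_def) (auto simp: at_pos_def ge_pos_def)

lemma var_cases: "X = at_pos (pigeon X) (pos X) \<or> X = ge_pos (pigeon X) (pos X)"
proof (cases "even (snd (prod_decode X))")
  case True
  then have "X = at_pos (pigeon X) (pos X)" by (simp add: at_pos_def pigeon_def pos_def)
  then show ?thesis ..
next
  case False
  then have "X = ge_pos (pigeon X) (pos X)" by (simp add: ge_pos_def pigeon_def pos_def)
  then show ?thesis ..
qed

definition pigeons :: "nat clause \<Rightarrow> nat set" where
  "pigeons C = (\<lambda>l. pigeon (lit_var l)) ` C"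

lemma pigeons_simps [simp]:
  "pigeons {} = {}" "pigeons (insert l C) = insert (pigeon (lit_var l)) (pigeons C)"
  "pigeons (C \<union> D) = pigeons C \<union> pigeons D"
  by (auto simp: pigeons_def)

lemma php_pigeons: "C \<in> php V K n \<Longrightarrow> pigeons C \<subseteq> V"
  by (induction rule: php.induct) auto

lemma deriv_php_pigeons: "deriv (php V K n) S C \<Longrightarrow> pigeons C \<subseteq> V"
  by (induction rule: deriv.induct) (auto dest!: php_pigeons elim!: is_resolventE)

section \<open>Clause width, number of variables and number of clauses\<close>

lemma php_clause: "C \<in> php V K n \<Longrightarrow> finite C \<and> card C \<le> 3"
  by (induction rule: php.induct) (auto simp: card_insert_if)

lemma php_vars:
  "cnf_vars (php V K n) \<subseteq> (\<lambda>(v, i). at_pos v i) ` (V \<times> {..K * n}) \<union> (\<lambda>(v, i). ge_pos v i) ` (V \<times> {..K * n})"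
proof -
  have "lit_var ` C \<subseteq> (\<lambda>(v, i). at_pos v i) ` (V \<times> {..K * n}) \<union> (\<lambda>(v, i). ge_pos v i) ` (V \<times> {..K * n})"
    if "C \<in> php V K n" for C
    using that by (induction rule: php.induct) force+
  then show ?thesis by (auto simp: cnf_vars_def)
qed

text \<open>The pigeon is part of the variable; this is why the formula takes a set of pigeons and
  not just their number.\<close>

lemma php_vars_disjoint:
  assumes "V \<inter> W = {}"
  shows "cnf_vars (php V K n) \<inter> cnf_vars (php W L m) = {}"
proof -
  have "pigeon ` cnf_vars (php U K n) \<subseteq> U" for U K n
    using php_pigeons[of _ U K n] unfolding cnf_vars_def pigeons_def by blast
  then show ?thesis using assms by blast
qed

lemma card_php_vars:
  assumes "finite V"
  shows "finite (cnf_vars (php V K n))" "card (cnf_vars (php V K n)) \<le> 2 * (card V * Suc (K * n))"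
proof -
  let ?A = "V \<times> {..K * n}" let ?f = "\<lambda>(v, i). at_pos v i" let ?g = "\<lambda>(v, i). ge_pos v i"
  have fin: "finite (?f ` ?A \<union> ?g ` ?A)" using assms by auto
  show "finite (cnf_vars (php V K n))" using php_vars fin by (rule finite_subset)
  have "card (cnf_vars (php V K n)) \<le> card (?f ` ?A \<union> ?g ` ?A)"
    using php_vars fin by (intro card_mono)
  also have "\<dots> \<le> card (?f ` ?A) + card (?g ` ?A)" by (rule card_Un_le)
  also have "\<dots> \<le> card ?A + card ?A" using assms by (intro add_mono card_image_le) auto
  finally show "card (cnf_vars (php V K n)) \<le> 2 * (card V * Suc (K * n))"
    by (simp add: card_cartesian_product)
qed

text \<open>The four kinds of clauses are covered by images of one set, whose elements are two
  (pigeon, position) pairs. Only the hole clauses use both pairs, hence the square.\<close>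

lemma card_php:
  assumes "finite V"
  shows "finite (php V K n)" "card (php V K n) \<le> 4 * (card V * Suc (K * n))\<^sup>2"
proof -
  define A where "A = V \<times> {..K * n}"
  define f1 f2 f3 f4 where
    "f1 = (\<lambda>((v :: nat, i :: nat), w :: nat \<times> nat). {Pos (ge_pos v 0)})" and
    "f2 = (\<lambda>((v :: nat, i :: nat), w :: nat \<times> nat). {Neg (ge_pos v (K * n))})" and
    "f3 = (\<lambda>((v :: nat, i :: nat), w :: nat \<times> nat). {Neg (ge_pos v i), Pos (at_pos v i), Pos (ge_pos v (Suc i))})" and
    "f4 = (\<lambda>((u :: nat, i :: nat), (v :: nat, j :: nat)). {Neg (at_pos u i), Neg (at_pos v j)})"
  let ?P = "A \<times> A"
  let ?U = "(f1 ` ?P \<union> f2 ` ?P) \<union> (f3 ` ?P \<union> f4 ` ?P)"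
  have finA: "finite ?P" using assms by (auto simp: A_def)
  have sub: "php V K n \<subseteq> ?U"
  proof
    fix C assume "C \<in> php V K n"
    then show "C \<in> ?U"
    proof (induction rule: php.induct)
      case (start v)
      then have "f1 ((v, 0), (v, 0)) \<in> f1 ` ?P" by (intro imageI) (auto simp: A_def)
      then show ?case by (auto simp: f1_def)
    next
      case (stop v)
      then have "f2 ((v, 0), (v, 0)) \<in> f2 ` ?P" by (intro imageI) (auto simp: A_def)
      then show ?case by (auto simp: f2_def)
    next
      case (step v i)
      then have "f3 ((v, i), (v, 0)) \<in> f3 ` ?P" by (intro imageI) (auto simp: A_def)
      then show ?case by (auto simp: f3_def)
    next
      case (hole u v i j)
      then have "f4 ((u, i), (v, j)) \<in> f4 ` ?P" by (intro imageI) (auto simp: A_def)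
      then show ?case by (auto simp: f4_def)
    qed
  qed
  have fin: "finite ?U" using finA by auto
  show "finite (php V K n)" using sub fin by (rule finite_subset)
  have "card (php V K n) \<le> card ?U" using sub fin by (intro card_mono)
  also have "\<dots> \<le> (card (f1 ` ?P) + card (f2 ` ?P)) + (card (f3 ` ?P) + card (f4 ` ?P))"
    by (intro order.trans[OF card_Un_le] add_mono card_Un_le)
  also have "\<dots> \<le> (card ?P + card ?P) + (card ?P + card ?P)"
    using finA by (intro add_mono card_image_le)
  also have "\<dots> = 4 * (card V * Suc (K * n))\<^sup>2"
    by (simp add: A_def card_cartesian_product power2_eq_square)
  finally show "card (php V K n) \<le> 4 * (card V * Suc (K * n))\<^sup>2" .
qed

section \<open>Changing a placement\<close>

lemma sat_placement_cong:
  assumes "\<And>l. l \<in> C \<Longrightarrow> placement f (lit_var l) = placement g (lit_var l)"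
  shows "sat (placement f) C = sat (placement g) C"
proof -
  have "lit_true (placement f) l = lit_true (placement g) l" if "l \<in> C" for l
    using assms[OF that] by (cases l) auto
  then show ?thesis by blast
qed

lemma placement_upd_other: "pigeon X \<noteq> v \<Longrightarrow> placement (f(v := i)) X = placement f X"
  by (auto simp: placement_def)

lemma free_hole:
  assumes "finite U" "card U < K"
  shows "\<exists>h<K. h \<notin> f ` U"
proof (rule ccontr)
  assume "\<not> (\<exists>h<K. h \<notin> f ` U)"
  then have "{..<K} \<subseteq> f ` U" by auto
  then have "card {..<K} \<le> card (f ` U)" using assms by (intro card_mono) auto
  then show False using assms card_image_le[of U f] by auto
qed

section \<open>The width bound\<close>

text \<open>A clause of width at most \<open>K\<close> with a literal of the new pigeon leaves a hole free for it.
  Two labels suffice to choose the position in that hole so that the variable resolved upon takes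
  the value wanted.\<close>

lemma no_narrow_deriv:
  assumes "deriv (php V K n) (narrow K) C" "n \<ge> 2" "\<And>v. v \<in> V \<Longrightarrow> f v < K * n"
    "inj_on (\<lambda>v. f v mod K) (pigeons C)"
  shows "sat (placement f) C"
  using assms(1,3,4)
proof (induction arbitrary: f rule: deriv.induct)
  case (axiom C)
  \<comment> \<open>Only a hole clause could fail, and then its two pigeons would share a hole,
    against injectivity.\<close>
  then show ?case
    by cases (auto simp: inj_on_def not_le Suc_le_eq)
next
  case (resolve C D E)
  obtain X \<gamma> \<delta> where CD: "C = insert (Pos X) \<gamma>" "D = insert (Neg X) \<delta>" "E = \<gamma> \<union> \<delta>"
    using resolve.hyps(3) by (rule is_resolventE)
  define v where "v = pigeon X"
  have vV: "v \<in> V" using deriv_php_pigeons[OF resolve.hyps(1)] CD by (simp add: v_def)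
  have Kn: "K \<le> K * n" "2 * K \<le> K * n" using assms(2) by auto
  show ?case
  proof (cases "v \<in> pigeons E")
    case True
    then have "pigeons C \<subseteq> pigeons E" "pigeons D \<subseteq> pigeons E" using CD by (auto simp: v_def)
    then have "inj_on (\<lambda>v. f v mod K) (pigeons C)" "inj_on (\<lambda>v. f v mod K) (pigeons D)"
      using resolve.prems(2) inj_on_subset by blast+
    then have "sat (placement f) C" "sat (placement f) D"
      using resolve.IH resolve.prems(1) by blast+
    then show ?thesis by (rule resolvent_sat[OF resolve.hyps(3)])
  next
    case False
    have nv: "v \<notin> pigeons \<gamma>" "v \<notin> pigeons \<delta>" using False CD by auto
    \<comment> \<open>\<open>l\<close> is the only literal of \<open>v\<close>, so at most
      \<open>K - 1\<close> literals, and hence pigeons, remain in \<open>\<beta>\<close>.\<close>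
    have free: "\<exists>h<K. h \<notin> (\<lambda>v. f v mod K) ` pigeons \<beta>"
      if "insert l \<beta> \<in> narrow K" "pigeon (lit_var l) = v" "v \<notin> pigeons \<beta>" for l \<beta>
    proof (intro free_hole)
      have l: "l \<notin> \<beta>" using that by (auto simp: pigeons_def)
      have fin: "finite \<beta>" using that by (simp add: narrow_def)
      then have "card \<beta> < K" using that l by (simp add: narrow_def)
      then show "card (pigeons \<beta>) < K" "finite (pigeons \<beta>)"
        using fin card_image_le[of \<beta>] unfolding pigeons_def by (auto intro: le_less_trans)
    qed
    \<comment> \<open>The pigeons of \<open>\<gamma>\<close> and \<open>\<delta>\<close> together
      may occupy all holes, so \<open>v\<close> is moved with a view to one premise only.\<close>
    obtain c where c: "c < K" "c \<notin> (\<lambda>v. f v mod K) ` pigeons \<gamma>"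
      using free[of "Pos X" \<gamma>] deriv_in[OF resolve.hyps(1)] CD nv by (auto simp: v_def)
    obtain d where d: "d < K" "d \<notin> (\<lambda>v. f v mod K) ` pigeons \<delta>"
      using free[of "Neg X" \<delta>] deriv_in[OF resolve.hyps(2)] CD nv by (auto simp: v_def)
    have move: "sat (placement (f(v := j))) (insert l \<beta>)"
      if "deriv (php V K n) (narrow K) (insert l \<beta>)" "pigeon (lit_var l) = v" "v \<notin> pigeons \<beta>"
        "\<beta> \<subseteq> E" "j < K * n" "j mod K \<notin> (\<lambda>v. f v mod K) ` pigeons \<beta>"
        "\<And>g. (\<And>v. v \<in> V \<Longrightarrow> g v < K * n) \<Longrightarrow> inj_on (\<lambda>v. g v mod K) (pigeons (insert l \<beta>)) \<Longrightarrow>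
          sat (placement g) (insert l \<beta>)" for l \<beta> j
    proof (rule that(7))
      show "(f(v := j)) u < K * n" if "u \<in> V" for u using that resolve.prems(1) \<open>j < K * n\<close> by auto
      have "pigeons \<beta> \<subseteq> pigeons E" using \<open>\<beta> \<subseteq> E\<close> by (auto simp: pigeons_def)
      then have "inj_on (\<lambda>v. f v mod K) (pigeons \<beta>)"
        using resolve.prems(2) by (rule inj_on_subset[rotated])
      then show "inj_on (\<lambda>u. (f(v := j)) u mod K) (pigeons (insert l \<beta>))"
        using that(2,3,6) by (auto simp: inj_on_def image_iff)
    qed
    have unchanged: "sat (placement f) \<beta>" if "sat (placement (f(v := j))) \<beta>" "v \<notin> pigeons \<beta>" for \<beta> j
    proof -
      have "sat (placement (f(v := j))) \<beta> = sat (placement f) \<beta>"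
        using that(2) by (intro sat_placement_cong placement_upd_other) (auto simp: pigeons_def)
      then show ?thesis using that by blast
    qed
    \<comment> \<open>With \<open>v\<close> at \<open>j\<close>, a false \<open>X\<close> forces
      \<open>\<gamma>\<close> to be true and a true \<open>X\<close> forces \<open>\<delta>\<close>.
      Neither mentions \<open>v\<close>, so they stay true under \<open>f\<close>.\<close>
    have "(\<exists>j<K * n. j mod K = c \<and> \<not> placement (f(v := j)) X) \<or>
      (\<exists>j<K * n. j mod K = d \<and> placement (f(v := j)) X)"
    proof (cases "X = at_pos v (pos X)")
      case True
      then have "placement (f(v := j)) X \<longleftrightarrow> j = pos X" for j
        by (metis fun_upd_same placement_simps(1))
      \<comment> \<open>These are the positions of hole \<open>c\<close> with labels 0 and 1; at
        most one of them is \<open>pos X\<close>.\<close>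
      moreover have "c < K * n" "c + K < K * n" using c Kn by linarith+
      moreover have "(c + K) mod K = c" "c mod K = c" using c by auto
      moreover have "c \<noteq> c + K" using c by auto
      ultimately show ?thesis by metis
    next
      case False
      then have "X = ge_pos v (pos X)" using var_cases[of X] v_def by auto
      then have pl: "placement (f(v := j)) X \<longleftrightarrow> pos X \<le> j" for j
        by (metis fun_upd_same placement_simps(2))
      \<comment> \<open>A threshold below \<open>K\<close> is met by the position of hole
        \<open>d\<close> with label 1; a larger one is missed by the position of hole
        \<open>c\<close> with label 0.\<close>
      show ?thesis
      proof (cases "pos X < K")
        case True
        have "d + K < K * n" "pos X \<le> d + K" using d Kn True by linarith+
        moreover have "(d + K) mod K = d" using d by simp
        ultimately show ?thesis using pl by metis
      next
        case False
        have "c < K * n" "\<not> pos X \<le> c" using c Kn False by linarith+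
        moreover have "c mod K = c" using c by simp
        ultimately show ?thesis using pl by metis
      qed
    qed
    then show ?thesis
    proof (elim disjE exE conjE)
      fix j assume j: "j < K * n" "j mod K = c" "\<not> placement (f(v := j)) X"
      have "sat (placement (f(v := j))) (insert (Pos X) \<gamma>)"
        by (rule move) (use j c nv CD resolve.hyps resolve.IH v_def in auto)
      then have "sat (placement (f(v := j))) \<gamma>" using j by auto
      then show ?thesis using unchanged nv CD by blast
    next
      fix j assume j: "j < K * n" "j mod K = d" "placement (f(v := j)) X"
      have "sat (placement (f(v := j))) (insert (Neg X) \<delta>)"
        by (rule move) (use j d nv CD resolve.hyps resolve.IH v_def in auto)
      then have "sat (placement (f(v := j))) \<delta>" using j by auto
      then show ?thesis using unchanged nv CD by blast
    qed
  qed
qed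

lemma no_narrow_refutation:
  assumes "K > 0" "n \<ge> 2"
  shows "\<not> deriv (php V K n) (narrow K) {}"
  using no_narrow_deriv[of V K n "{}" "\<lambda>_. 0"] assms by auto

section \<open>The length bound\<close>

text \<open>A variable whose label differs from the one that \<open>t\<close> gives to its pigeon is
  constant once \<open>t\<close> is fixed; these are the pigeons that the clause still depends
  on.\<close>

definition live :: "nat \<Rightarrow> (nat \<Rightarrow> nat) \<Rightarrow> nat clause \<Rightarrow> nat set" where
  "live K t C = {pigeon (lit_var l) |l. l \<in> C \<and> pos (lit_var l) div K = t (pigeon (lit_var l))}"

text \<open>If the labels \<open>t\<close> are fixed and only the holes \<open>h\<close> may vary, then the formula becomes the
  pigeonhole principle with \<open>K\<close> holes on the variables whose label agrees with \<open>t\<close>.\<close>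

lemma placement_not_live:
  assumes "pos X div K \<noteq> t (pigeon X)" "h (pigeon X) < K" "h' (pigeon X) < K"
  shows "placement (\<lambda>v. h v + K * t v) X = placement (\<lambda>v. h' v + K * t v) X"
proof -
  let ?v = "pigeon X"
  have div: "(c + K * t ?v) div K = t ?v" if "c < K" for c
    using that by simp
  have a: "h ?v + K * t ?v \<noteq> pos X" "h' ?v + K * t ?v \<noteq> pos X"
    using div[OF assms(2)] div[OF assms(3)] assms by metis+
  have K: "pos X = pos X mod K + K * (pos X div K)" "pos X mod K < K" using assms by auto
  \<comment> \<open>Positions are ordered by label first, so different labels alone decide the
    comparison.\<close>
  have "pos X \<le> c + K * t ?v \<longleftrightarrow> pos X div K \<le> t ?v" if "c < K" for c
  proof
    assume "pos X \<le> c + K * t ?v"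
    then have "pos X div K \<le> (c + K * t ?v) div K" by (rule div_le_mono)
    then show "pos X div K \<le> t ?v" using div[OF that] by simp
  next
    assume "pos X div K \<le> t ?v"
    then have "Suc (pos X div K) \<le> t ?v" using assms(1) by simp
    then have "K * Suc (pos X div K) \<le> K * t ?v" by (rule mult_le_mono2)
    then show "pos X \<le> c + K * t ?v" using K unfolding mult_Suc_right by linarith
  qed
  from this[OF assms(2)] this[OF assms(3)] show ?thesis using a by (simp add: placement_def)
qed

text \<open>Live pigeons take the role of the pigeons in the width bound. As the conclusion
  \<open>E\<close> itself has fewer than \<open>K\<close> of them, a single free hole for the pigeon
  resolved upon serves both premises.\<close>

lemma no_deriv_few_live:
  assumes "deriv (php V K n) S C" "\<And>C. C \<in> S \<Longrightarrow> finite C \<and> card (live K t C) < K"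
    "\<And>v. v \<in> V \<Longrightarrow> t v < n" "\<And>v. h v < K" "inj_on h (live K t C)"
  shows "sat (placement (\<lambda>v. h v + K * t v)) C"
  using assms(1,4,5)
proof (induction arbitrary: h rule: deriv.induct)
  case (axiom C)
  have bound: "h v + K * t v < K * n" if "v \<in> V" for v
  proof -
    have "K * Suc (t v) \<le> K * n" using assms(3)[OF that] by (intro mult_le_mono2) simp
    then show ?thesis using axiom.prems(1)[of v] by simp
  qed
  from axiom.hyps(1) show ?case
  proof cases
    case (hole u v i j)
    show ?thesis
    proof (rule ccontr)
      assume "\<not> ?thesis"
      \<comment> \<open>If both literals are false, the pigeons sit at \<open>i\<close> and
        \<open>j\<close>. So these positions carry the labels given by \<open>t\<close>, and both
        pigeons are live and in the same hole.\<close>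
      then have ij: "i = h u + K * t u" "j = h v + K * t v" using hole by auto
      then have "i div K = t u" "j div K = t v" "h u = h v"
        using axiom.prems(1)[of u] axiom.prems(1)[of v] hole by simp_all
      moreover from this have "u \<in> live K t C" "v \<in> live K t C"
        using hole by (force simp: live_def)+
      ultimately show False using axiom.prems(2) hole by (auto simp: inj_on_def)
    qed
  qed (use bound in \<open>auto simp: not_le Suc_le_eq\<close>)
next
  case (resolve C D E)
  obtain X \<gamma> \<delta> where CD: "C = insert (Pos X) \<gamma>" "D = insert (Neg X) \<delta>" "E = \<gamma> \<union> \<delta>"
    using resolve.hyps(3) by (rule is_resolventE)
  define v where "v = pigeon X"
  have sub: "live K t C \<subseteq> insert v (live K t E)" "live K t D \<subseteq> insert v (live K t E)"
    using CD by (auto simp: live_def v_def)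
  show ?case
  proof (cases "v \<in> live K t E \<or> pos X div K \<noteq> t v")
    case True
    then have "live K t C \<subseteq> live K t E" "live K t D \<subseteq> live K t E"
      using CD by (auto simp: live_def v_def)
    then have "inj_on h (live K t C)" "inj_on h (live K t D)"
      using resolve.prems(2) inj_on_subset by blast+
    then have "sat (placement (\<lambda>v. h v + K * t v)) C" "sat (placement (\<lambda>v. h v + K * t v)) D"
      using resolve.IH resolve.prems(1) by blast+
    then show ?thesis by (rule resolvent_sat[OF resolve.hyps(3)])
  next
    case False
    have E: "finite E" "card (live K t E) < K" using assms(2) resolve.hyps by auto
    have "live K t E \<subseteq> (\<lambda>l. pigeon (lit_var l)) ` E" by (auto simp: live_def)
    then have "finite (live K t E)" using E by (auto intro: finite_subset)
    then obtain c where c: "c < K" "c \<notin> h ` live K t E" using free_hole E by metis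
    define g where "g = h(v := c)"
    have g: "g u < K" for u using resolve.prems(1) c by (simp add: g_def)
    have "inj_on g (insert v (live K t E))"
      using False c resolve.prems(2) by (auto simp: g_def inj_on_def image_iff)
    then have "inj_on g (live K t C)" "inj_on g (live K t D)"
      using sub inj_on_subset by blast+
    then have "sat (placement (\<lambda>v. g v + K * t v)) E"
      using resolve.IH g resolvent_sat[OF resolve.hyps(3)] by blast
    \<comment> \<open>\<open>v\<close> is not live in \<open>E\<close>: its literals there carry
      other labels, so moving \<open>v\<close> between holes under its label does not change
      them.\<close>
    moreover have "placement (\<lambda>v. g v + K * t v) (lit_var l) = placement (\<lambda>v. h v + K * t v) (lit_var l)"
      if "l \<in> E" for l
    proof (cases "pigeon (lit_var l) = v")
      case True
      then have "pos (lit_var l) div K \<noteq> t (pigeon (lit_var l))"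
        using False that by (auto simp: live_def)
      then show ?thesis using g resolve.prems(1) by (intro placement_not_live)
    qed (simp add: placement_def g_def)
    ultimately show ?thesis using sat_placement_cong by blast
  qed
qed

text \<open>Each of the \<open>n ^ (K + 1)\<close> labellings makes \<open>K\<close> pigeons live in
  some clause \<open>C\<close>. It then lies in a box \<open>R C u\<close>: arbitrary at one pigeon
  \<open>u\<close>, elsewhere one of the at most \<open>w\<close> labels in \<open>C\<close>. The
  boxes have at most \<open>n * w ^ K\<close> elements each, and one factor \<open>n\<close>
  cancels.\<close>

lemma deriv_many_clauses:
  assumes "deriv (php V K n) S {}" "finite S" "\<And>C. C \<in> S \<Longrightarrow> finite C \<and> card C \<le> w"
    "finite V" "card V = Suc K" "K > 0" "n > 0"
  shows "n ^ K \<le> card S * (Suc K * w ^ K)"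
proof -
  define lab :: "nat clause \<Rightarrow> nat set" where "lab C = (\<lambda>l. pos (lit_var l) div K) ` C" for C
  define R where "R C u = PiE V (\<lambda>v. if v = u then {..<n} else lab C)" for C u
  have lab: "finite (lab C)" "card (lab C) \<le> w" if "C \<in> S" for C
    using assms(3)[OF that] card_image_le[of C "\<lambda>l. pos (lit_var l) div K"]
    unfolding lab_def by auto
  have "PiE V (\<lambda>_. {..<n}) \<subseteq> (\<Union>(C, u)\<in>S \<times> V. R C u)"
  proof
    fix t assume t: "t \<in> PiE V (\<lambda>_. {..<n})"
    have "\<exists>C\<in>S. K \<le> card (live K t C \<inter> V)"
    proof (rule ccontr)
      \<comment> \<open>\<open>S\<close> may contain clauses about pigeons outside \<open>V\<close>,
        such as those of another formula; no derivation from \<open>php V K n\<close> reaches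
        them.\<close>
      let ?S = "{C \<in> S. pigeons C \<subseteq> V}"
      assume neg: "\<not> ?thesis"
      have sub: "live K t C \<inter> V = live K t C" if "C \<in> ?S" for C
        using that by (auto simp: live_def pigeons_def)
      have "deriv (php V K n) ?S C" if "deriv (php V K n) S C" for C
        using that
      proof (induction rule: deriv.induct)
        case (axiom C)
        then show ?case using php_pigeons[of C V K n] by (intro deriv.axiom) auto
      next
        case (resolve C D E)
        have "deriv (php V K n) S E" using resolve.hyps by (rule deriv.resolve)
        then have "pigeons E \<subseteq> V" by (rule deriv_php_pigeons)
        then show ?case using resolve by (auto intro: deriv.resolve)
      qed
      then have "deriv (php V K n) ?S {}" using assms(1) by blast
      then have "sat (placement (\<lambda>v. 0 + K * t v)) {}"
      proof (rule no_deriv_few_live)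
        show "finite C \<and> card (live K t C) < K" if "C \<in> ?S" for C
          using neg sub[OF that] that assms(3) by (force simp: not_le)
      qed (use t assms in \<open>auto simp: live_def\<close>)
      then show False by simp
    qed
    then obtain C where C: "C \<in> S" "K \<le> card (live K t C \<inter> V)" by blast
    \<comment> \<open>Of the \<open>K + 1\<close> pigeons at most one is not live; \<open>u\<close>
      is that one, or any pigeon if all are live.\<close>
    have "card (V - live K t C) = card V - card (live K t C \<inter> V)"
      using assms(4) by (subst Int_commute) (simp add: card_Diff_subset_Int)
    then have "card (V - live K t C) \<le> 1" using C assms(5) by simp
    moreover have "V \<noteq> {}" using assms(5) by auto
    ultimately obtain u where u: "u \<in> V" "V - live K t C \<subseteq> {u}"
      using assms(4) by (auto simp: card_le_Suc0_iff_eq) blast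
    have "t \<in> R C u"
      unfolding R_def
    proof (rule PiE_I)
      fix v assume v: "v \<in> V"
      have "t v \<in> lab C" if "v \<noteq> u"
      proof -
        have "v \<in> live K t C" using u v that by blast
        then obtain l where "l \<in> C" "pos (lit_var l) div K = t v" by (auto simp: live_def)
        then show ?thesis unfolding lab_def by (metis imageI)
      qed
      then show "t v \<in> (if v = u then {..<n} else lab C)" using t v by auto
    qed (use t in auto)
    then show "t \<in> (\<Union>(C, u)\<in>S \<times> V. R C u)" using C u by auto
  qed
  moreover have finR: "finite (R C u)" if "C \<in> S" for C u
    using lab[OF that] assms(4) by (auto simp: R_def intro: finite_PiE)
  ultimately have "card (PiE V (\<lambda>_. {..<n})) \<le> card (\<Union>(C, u)\<in>S \<times> V. R C u)"
    using assms(2,4) by (intro card_mono) auto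
  also have "\<dots> \<le> (\<Sum>(C, u)\<in>S \<times> V. card (R C u))"
    using assms(2,4) card_UN_le[of "S \<times> V" "\<lambda>(C, u). R C u"] by (simp add: case_prod_unfold)
  also have "\<dots> \<le> (\<Sum>x\<in>S \<times> V. n * w ^ K)"
  proof (intro sum_mono, clarify)
    fix C u assume "C \<in> S" "u \<in> V"
    have "card (R C u) = (\<Prod>v\<in>V. if v = u then n else card (lab C))"
      unfolding R_def using assms(4) by (simp add: card_PiE if_distrib cong: if_cong)
    also have "\<dots> = n * card (lab C) ^ K"
      using assms(4,5) \<open>u \<in> V\<close>
      by (simp add: prod.If_cases Diff_eq[symmetric] card_Diff_singleton
        Int_absorb1[of "{u}" V, simplified])
    also have "\<dots> \<le> n * w ^ K" using lab[OF \<open>C \<in> S\<close>] by (intro mult_le_mono2 power_mono) auto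
    finally show "card (R C u) \<le> n * w ^ K" .
  qed
  also have "\<dots> = n * (card S * (Suc K * w ^ K))"
    using assms(5) by (simp add: card_cartesian_product algebra_simps)
  finally have "n * n ^ K \<le> n * (card S * (Suc K * w ^ K))"
    using assms(4,5) by (simp add: card_PiE)
  then show ?thesis using assms(7) by simp
qed

section \<open>A narrow refutation\<close>

text \<open>Passing to a subclause replaces weakening, so that premises can be padded to a common
  side clause. The padded clause itself may be wider than \<open>w\<close>.\<close>

definition subderiv :: "'v clause set \<Rightarrow> nat \<Rightarrow> 'v clause \<Rightarrow> bool" where
  "subderiv \<Gamma> w C \<longleftrightarrow> (\<exists>C'\<subseteq>C. deriv \<Gamma> (narrow w) C')"

lemma subderiv_axiom: "C \<in> \<Gamma> \<Longrightarrow> finite C \<Longrightarrow> card C \<le> w \<Longrightarrow> C \<subseteq> C' \<Longrightarrow> subderiv \<Gamma> w C'"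
  unfolding subderiv_def by (auto simp: narrow_def intro: deriv.axiom)

text \<open>If the derived subclause of a premise lacks the literal resolved upon, it is already
  contained in \<open>\<gamma>\<close>. Otherwise the two subclauses have a resolvent inside
  \<open>\<gamma>\<close>.\<close>

lemma subderiv_resolve:
  assumes "subderiv \<Gamma> w (insert (Pos X) \<gamma>)" "subderiv \<Gamma> w (insert (Neg X) \<gamma>)"
    "finite \<gamma>" "card \<gamma> \<le> w"
  shows "subderiv \<Gamma> w \<gamma>"
proof -
  obtain C D where CD: "C \<subseteq> insert (Pos X) \<gamma>" "deriv \<Gamma> (narrow w) C"
    "D \<subseteq> insert (Neg X) \<gamma>" "deriv \<Gamma> (narrow w) D"
    using assms unfolding subderiv_def by blast
  show ?thesis
  proof (cases "Pos X \<in> C \<and> Neg X \<in> D")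
    case True
    let ?E = "(C - {Pos X}) \<union> (D - {Neg X})"
    have E: "?E \<subseteq> \<gamma>" using CD by auto
    have "is_resolvent C D ?E" unfolding is_resolvent_def
      using True by (intro exI[of _ X] exI[of _ "C - {Pos X}"] exI[of _ "D - {Neg X}"]) auto
    moreover have "?E \<in> narrow w"
      using E assms(3,4) card_mono[OF assms(3) E] finite_subset[OF E] by (simp add: narrow_def)
    ultimately have "deriv \<Gamma> (narrow w) ?E" using CD by (blast intro: deriv.resolve)
    then show ?thesis using E unfolding subderiv_def by blast
  next
    case False
    then have "C \<subseteq> \<gamma> \<or> D \<subseteq> \<gamma>" using CD by blast
    then show ?thesis using CD unfolding subderiv_def by blast
  qed
qed

lemma subderiv_mono: "subderiv \<Gamma> w C \<Longrightarrow> C \<subseteq> C' \<Longrightarrow> subderiv \<Gamma> w C'"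
  unfolding subderiv_def by blast

lemma card_insert_le_Suc: "card (insert a A) \<le> Suc (card A)"
  by (cases "finite A") (auto simp: card_insert_if)

lemma card_2_le: "2 \<le> w \<Longrightarrow> card {a, b} \<le> w"
  by (auto simp: card_insert_if)

lemma card_3_le: "3 \<le> w \<Longrightarrow> card {a, b, c} \<le> w"
  by (auto simp: card_insert_if)

text \<open>The positions of a pigeon are eliminated from the last one to the first. A position in a
  hole already taken by \<open>u\<close> is eliminated with the hole clause alone, before the remaining
  literals are added, which keeps the width at \<open>K + 1\<close> even when all holes are taken.\<close>

lemma php_subderiv_placement:
  assumes "card V = Suc K" "finite V" "K \<ge> 2"
    "U \<subseteq> V" "\<And>u. u \<in> U \<Longrightarrow> g u < K * n" "inj_on (\<lambda>u. g u mod K) U"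
  shows "subderiv (php V K n) (Suc K) ((\<lambda>u. Neg (at_pos u (g u))) ` U)"
  using assms(4-6)
\<comment> \<open>The induction is on the number of holes that \<open>U\<close> leaves free.\<close>
proof (induction "K - card U" arbitrary: U g rule: less_induct)
  case less
  let ?\<Gamma> = "php V K n"
  let ?N = "(\<lambda>u. Neg (at_pos u (g u))) ` U"
  have finU: "finite U" using less.prems(1) assms(2) by (rule finite_subset)
  have "card U = card ((\<lambda>u. g u mod K) ` U)" using less.prems(3) by (simp add: card_image)
  also have "\<dots> \<le> card {..<K}" using assms(3) by (intro card_mono) auto
  finally have cU: "card U \<le> K" by simp
  then have "U \<noteq> V" using assms(1) by auto
  then obtain v where v: "v \<in> V" "v \<notin> U" using less.prems(1) by blast
  have cN: "finite ?N" "card ?N \<le> card U" using finU by (auto intro: card_image_le)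
  have cN1: "card (insert a ?N) \<le> Suc (card U)" for a
    using card_insert_le_Suc[of a ?N] cN(2) by linarith
  have cN2: "card (insert a (insert b ?N)) \<le> Suc (Suc (card U))" for a b
    using card_insert_le_Suc[of a "insert b ?N"] cN1[of b] by linarith
  \<comment> \<open>Read as: if the pigeons of \<open>U\<close> sit as \<open>g\<close> says, then
    \<open>v\<close> is not at position \<open>i\<close> or later. The induction descends from
    \<open>K * n\<close>, where this is the \<open>stop\<close> clause.\<close>
  have chain: "subderiv ?\<Gamma> (Suc K) (insert (Neg (ge_pos v i)) ?N)" if "i \<le> K * n" for i
    using that
  proof (induction i rule: inc_induct)
    case base
    show ?case using v by (intro subderiv_axiom[OF php.stop[of v]]) auto
  next
    case (step i)
    have i: "i < K * n" using step by simp
    let ?T = "insert (Neg (ge_pos v i)) (insert (Pos (ge_pos v (Suc i))) ?N)"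
    have ax: "subderiv ?\<Gamma> (Suc K) C" if "{Neg (ge_pos v i), Pos (at_pos v i), Pos (ge_pos v (Suc i))} \<subseteq> C" for C
      using assms(3) that by (intro subderiv_axiom[OF php.step[OF v(1) i]] card_3_le) auto
    have "subderiv ?\<Gamma> (Suc K) ?T"
    proof (cases "\<exists>u\<in>U. g u mod K = i mod K")
      case True
      then obtain u where u: "u \<in> U" "g u mod K = i mod K" by blast
      \<comment> \<open>Three literals fit into width \<open>K + 1\<close> because
        \<open>K \<ge> 2\<close>.\<close>
      let ?T' = "{Neg (ge_pos v i), Pos (ge_pos v (Suc i)), Neg (at_pos u (g u))}"
      have uV: "u \<in> V" "u \<noteq> v" "g u < K * n" using u less.prems v by auto
      have "subderiv ?\<Gamma> (Suc K) (insert (Neg (at_pos v i)) ?T')"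
        using assms(3)
        by (intro subderiv_axiom[OF php.hole[OF uV(1) v(1) uV(2,3) i u(2)]] card_2_le) auto
      moreover have "subderiv ?\<Gamma> (Suc K) (insert (Pos (at_pos v i)) ?T')" by (rule ax) auto
      ultimately have "subderiv ?\<Gamma> (Suc K) ?T'"
        using assms(3) by - (rule subderiv_resolve[of _ _ "at_pos v i"], auto intro: card_3_le)
      then show ?thesis by (rule subderiv_mono) (use u in auto)
    next
      case False
      \<comment> \<open>The hole of \<open>i\<close> is free, so \<open>v\<close> can be added to
        \<open>U\<close> at position \<open>i\<close>. Since then \<open>card U < K\<close>, the
        \<open>card U + 2\<close> literals of \<open>?T\<close> fit into width
        \<open>K + 1\<close>.\<close>
      have "card U \<noteq> K"
      proof
        assume "card U = K"
        then have "card ((\<lambda>u. g u mod K) ` U) = K" using less.prems(3) by (simp add: card_image)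
        moreover have "(\<lambda>u. g u mod K) ` U \<subseteq> {..<K} - {i mod K}" using False assms(3) by auto
        then have "card ((\<lambda>u. g u mod K) ` U) \<le> card ({..<K} - {i mod K})"
          by (intro card_mono) auto
        moreover have "card ({..<K} - {i mod K}) < K"
          using assms(3) by (simp add: card_Diff_singleton)
        ultimately show False by simp
      qed
      then have lt: "card U < K" using cU by simp
      let ?g = "g(v := i)"
      have "subderiv ?\<Gamma> (Suc K) ((\<lambda>u. Neg (at_pos u (?g u))) ` insert v U)"
      proof (rule less.hyps)
        show "K - card (insert v U) < K - card U" using v finU lt by simp
        show "inj_on (\<lambda>u. ?g u mod K) (insert v U)"
          using less.prems(3) False v by (auto simp: inj_on_def)
      qed (use v less.prems i in auto)
      moreover have "(\<lambda>u. Neg (at_pos u (?g u))) ` insert v U = insert (Neg (at_pos v i)) ?N"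
        using v by auto
      ultimately have "subderiv ?\<Gamma> (Suc K) (insert (Neg (at_pos v i)) ?T)"
        by (auto elim: subderiv_mono)
      moreover have "subderiv ?\<Gamma> (Suc K) (insert (Pos (at_pos v i)) ?T)" by (rule ax) auto
      ultimately show ?thesis
        using cN(1) order.trans[OF cN2] lt by - (rule subderiv_resolve[of _ _ "at_pos v i"], auto)
    qed
    moreover have "subderiv ?\<Gamma> (Suc K) (insert (Neg (ge_pos v (Suc i))) (insert (Neg (ge_pos v i)) ?N))"
      using step.IH by (rule subderiv_mono) auto
    ultimately show ?case
      using cN(1) order.trans[OF cN1] cU
      by - (rule subderiv_resolve[of _ _ "ge_pos v (Suc i)"], auto simp: insert_commute)
  qed
  have "subderiv ?\<Gamma> (Suc K) (insert (Pos (ge_pos v 0)) ?N)"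
    using v by (intro subderiv_axiom[OF php.start[of v]]) auto
  then show ?case
    using chain[of 0] cN cU by - (rule subderiv_resolve[of _ _ "ge_pos v 0"], auto)
qed

lemma php_narrow_refutation:
  assumes "card V = Suc K" "K \<ge> 2"
  shows "deriv (php V K n) (narrow (Suc K)) {}"
proof -
  have "finite V" using assms by (intro card_ge_0_finite) simp
  then show ?thesis
    using php_subderiv_placement[of V K "{}" "\<lambda>_. 0" n] assms by (auto simp: subderiv_def)
qed

section \<open>The trade-off\<close>

theorem theorem5:
  fixes k :: nat
  assumes "k \<ge> 3"
  shows "\<exists>\<Gamma> :: nat \<Rightarrow> nat clause set.
     (\<forall>n\<ge>1. three_cnf (\<Gamma> n) \<and> unsatisfiable (\<Gamma> n) \<and> min_refutation_width (\<Gamma> n) = k) \<and>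
     (\<lambda>n. real (card (cnf_vars (\<Gamma> n)))) \<in> O(\<lambda>n. real n) \<and>
     (\<lambda>n. real (card (\<Gamma> n))) \<in> O(\<lambda>n. real n ^ 2) \<and>
     (\<exists>L :: nat \<Rightarrow> nat. (\<lambda>n. real (L n)) \<in> \<Omega>(\<lambda>n. real n ^ (k - 1)) \<and>
        (\<forall>n\<ge>1. \<forall>\<pi>. refutation (\<Gamma> n) \<pi> \<and> refutation_width \<pi> \<le> k \<longrightarrow> L n \<le> length \<pi>)) \<and>
     (\<exists>U :: nat \<Rightarrow> nat. (\<lambda>n. real (U n)) \<in> O(\<lambda>n. 1) \<and>
        (\<forall>n\<ge>1. \<exists>\<pi>. treelike_refutation (\<Gamma> n) \<pi> \<and> refutation_width \<pi> \<le> k + 1 \<and>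
           length \<pi> \<le> U n))"
proof -
  \<comment> \<open>\<open>V\<close> has one pigeon more than the \<open>k - 1\<close> holes of
    \<open>B n\<close>, and \<open>W\<close> one more than the \<open>k\<close> holes of
    \<open>A\<close>. With \<open>Suc n\<close> labels there are two already for
    \<open>n = 1\<close>, as the width bound requires.\<close>
  define V where "V = {..<k}"
  define W where "W = {k..<2 * k + 1}"
  define A where "A = php W k 2"
  define B where "B n = php V (k - 1) (Suc n)" for n
  define \<Gamma> where "\<Gamma> n = A \<union> B n" for n
  \<comment> \<open>The factor \<open>Suc K * w ^ K\<close> of the counting bound for
    \<open>K = k - 1\<close> and clauses of width \<open>k\<close>.\<close>
  define w where "w = k * k ^ (k - 1)"
  define L where "L n = nat \<lceil>real n ^ (k - 1) / real w\<rceil>" for n :: nat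
  have VW: "finite V" "finite W" "card V = Suc (k - 1)" "card W = Suc k" "V \<inter> W = {}"
    using assms by (auto simp: V_def W_def)
  have Vk: "card V = k" by (simp add: V_def)
  have size: "Suc ((k - 1) * Suc n) \<le> Suc ((k - 1) * 2) * n" if "n \<ge> 1" for n
  proof -
    have "1 + (k - 1) * Suc n \<le> n + (k - 1) * (2 * n)"
      using that by (intro add_mono mult_le_mono2) auto
    then show ?thesis by (simp add: algebra_simps)
  qed
  have w: "w > 0" using assms by (simp add: w_def)
  have cl: "finite C \<and> card C \<le> 3" if "C \<in> \<Gamma> n" for C n
    using that php_clause by (auto simp: \<Gamma>_def A_def B_def)
  have split: "deriv A S {} \<or> deriv (B n) S {}" if "deriv (\<Gamma> n) S {}" for n S
    using that unfolding \<Gamma>_def A_def B_def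
    by (rule deriv_disjoint_union) (use VW(5) in \<open>auto intro!: php_vars_disjoint\<close>)
  have narrow: "deriv (\<Gamma> n) {C \<in> set \<pi>. finite C} {}"
    "{C \<in> set \<pi>. finite C} \<subseteq> narrow (refutation_width \<pi>)"
    if "refutation (\<Gamma> n) \<pi>" for n \<pi>
    using deriv_finite[OF refutation_deriv[OF that]] cl
    by (auto simp: narrow_def refutation_width_def clause_width_def)
  have noA: "\<not> deriv A (narrow m) {}" if "m \<le> k" for m
    using no_narrow_refutation[of k 2 W] assms deriv_mono[OF _ order.refl narrow_mono[OF that]]
    by (auto simp: A_def)
  have noB: "\<not> deriv (B n) (narrow m) {}" if "m < k" "n \<ge> 1" for n m
  proof -
    have "m \<le> k - 1" using that by simp
    then show ?thesis
      using no_narrow_refutation[of "k - 1" "Suc n" V] assms that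
        deriv_mono[OF _ order.refl narrow_mono] by (fastforce simp: B_def)
  qed
  have yesA: "deriv A (narrow (k + 1)) {}"
    using php_narrow_refutation[of W k 2] VW assms by (simp add: A_def)
  have yes: "deriv (\<Gamma> n) (narrow k) {}" for n
  proof -
    have "deriv (B n) (narrow k) {}"
      using php_narrow_refutation[of V "k - 1" "Suc n"] VW assms by (simp add: B_def)
    then show ?thesis by (rule deriv_mono) (auto simp: \<Gamma>_def)
  qed
  have "finite (\<Gamma> n)" for n
    using card_php(1)[OF VW(1)] card_php(1)[OF VW(2)] by (simp add: \<Gamma>_def A_def B_def)
  then have "three_cnf (\<Gamma> n)" for n
    using cl by (simp add: three_cnf_def clause_width_def)
  moreover have "unsatisfiable (\<Gamma> n)" for n
  proof -
    have "\<not> (\<forall>C\<in>\<Gamma> n. sat \<alpha> C)" for \<alpha>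
      using deriv_sat[OF yes[of n], of \<alpha>] by auto
    then show ?thesis by (simp add: unsatisfiable_def)
  qed
  moreover have "min_refutation_width (\<Gamma> n) = k" if "n \<ge> 1" for n
  proof -
    have lower: "k \<le> refutation_width \<pi>" if ref: "refutation (\<Gamma> n) \<pi>" for \<pi>
    proof (rule ccontr)
      assume less: "\<not> ?thesis"
      have "deriv (\<Gamma> n) (narrow (refutation_width \<pi>)) {}"
        using deriv_mono[OF narrow(1)[OF ref] order.refl narrow(2)[OF ref]] .
      then show False using split noA noB less \<open>n \<ge> 1\<close> by fastforce
    qed
    obtain \<pi> where \<pi>: "refutation (\<Gamma> n) \<pi>" "refutation_width \<pi> \<le> k"
      using deriv_treelike[OF yes] by (auto simp: treelike_refutation_def)
    show ?thesis unfolding min_refutation_width_def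
      by (rule Least_equality) (use \<pi> lower le_antisym in blast)+
  qed
  moreover have "(\<lambda>n. real (card (cnf_vars (\<Gamma> n)))) \<in> O(\<lambda>n. real n)"
  proof -
    define c where "c = card (cnf_vars A)"
    define d where "d = c + 2 * (k * Suc ((k - 1) * 2))"
    have "card (cnf_vars (\<Gamma> n)) \<le> d * n" if "n \<ge> 1" for n
    proof -
      have "cnf_vars (\<Gamma> n) = cnf_vars A \<union> cnf_vars (B n)" by (auto simp: cnf_vars_def \<Gamma>_def)
      then have "card (cnf_vars (\<Gamma> n)) \<le> c + card (cnf_vars (B n))"
        by (simp add: c_def card_Un_le)
      also have "\<dots> \<le> c + 2 * (k * Suc ((k - 1) * Suc n))"
        using card_php_vars(2)[OF VW(1), of "k - 1" "Suc n"] unfolding B_def Vk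
        by (rule add_left_mono)
      also have "\<dots> \<le> c * n + 2 * (k * (Suc ((k - 1) * 2) * n))"
        using that size[OF that] by (intro add_mono mult_le_mono2) auto
      also have "\<dots> = d * n" by (simp add: d_def algebra_simps)
      finally show ?thesis .
    qed
    then have "\<forall>n\<ge>1. norm (real (card (cnf_vars (\<Gamma> n)))) \<le> real d * norm (real n)"
      by (auto simp flip: of_nat_mult)
    then show ?thesis by (intro bigoI[of _ "real d"]) (auto simp: eventually_sequentially)
  qed
  moreover have "(\<lambda>n. real (card (\<Gamma> n))) \<in> O(\<lambda>n. real n ^ 2)"
  proof -
    define c where "c = card A"
    define d where "d = c + 4 * (k * Suc ((k - 1) * 2))\<^sup>2"
    have "card (\<Gamma> n) \<le> d * n\<^sup>2" if "n \<ge> 1" for n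
    proof -
      have "card (\<Gamma> n) \<le> c + card (B n)" by (simp add: c_def \<Gamma>_def card_Un_le)
      also have "\<dots> \<le> c + 4 * (k * Suc ((k - 1) * Suc n))\<^sup>2"
        using card_php(2)[OF VW(1), of "k - 1" "Suc n"] unfolding B_def Vk
        by (rule add_left_mono)
      also have "\<dots> \<le> c * n\<^sup>2 + 4 * (k * (Suc ((k - 1) * 2) * n))\<^sup>2"
        using that size[OF that] by (intro add_mono mult_le_mono2 power_mono) auto
      also have "\<dots> = d * n\<^sup>2" by (simp only: d_def add_mult_distrib power_mult_distrib mult.assoc)
      finally show ?thesis .
    qed
    then have "\<forall>n\<ge>1. norm (real (card (\<Gamma> n))) \<le> real d * norm (real n ^ 2)"
      by (auto simp flip: of_nat_mult of_nat_power)
    then show ?thesis by (intro bigoI[of _ "real d"]) (auto simp: eventually_sequentially)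
  qed
  moreover have "\<exists>L :: nat \<Rightarrow> nat. (\<lambda>n. real (L n)) \<in> \<Omega>(\<lambda>n. real n ^ (k - 1)) \<and>
        (\<forall>n\<ge>1. \<forall>\<pi>. refutation (\<Gamma> n) \<pi> \<and> refutation_width \<pi> \<le> k \<longrightarrow> L n \<le> length \<pi>)"
  proof (intro exI[of _ L] conjI allI impI; (elim conjE)?)
    show "(\<lambda>n. real (L n)) \<in> \<Omega>(\<lambda>n. real n ^ (k - 1))"
    proof -
      have "real n ^ (k - 1) \<le> real w * real (L n)" for n
      proof -
        have "real n ^ (k - 1) / real w \<le> real (L n)" unfolding L_def by linarith
        then show ?thesis using w by (simp add: field_simps)
      qed
      then have "(\<lambda>n. real n ^ (k - 1)) \<in> O(\<lambda>n. real (L n))"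
        by (intro bigoI[of _ "real w"]) auto
      then show ?thesis by (simp add: bigomega_iff_bigo)
    qed
  next
    fix n \<pi>
    assume ref: "refutation (\<Gamma> n) \<pi>" "refutation_width \<pi> \<le> k"
    show "L n \<le> length \<pi>"
    proof -
      let ?S = "{C \<in> set \<pi>. finite C}"
      have S: "?S \<subseteq> narrow k" using narrow(2)[OF ref(1)] ref(2) by (auto simp: narrow_def)
      \<comment> \<open>\<open>A\<close> has no refutation of width \<open>k\<close>, so the clauses
        of the list must refute \<open>B n\<close>.\<close>
      then have "deriv (B n) ?S {}"
        using split[OF narrow(1)[OF ref(1)]] noA[of k] deriv_mono[of A ?S "{}" A "narrow k"] by auto
      then have "Suc n ^ (k - 1) \<le> card ?S * (Suc (k - 1) * k ^ (k - 1))"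
        unfolding B_def using S VW assms by (intro deriv_many_clauses[of V]) (auto simp: narrow_def)
      also have "\<dots> = card ?S * w" using assms by (simp add: w_def)
      also have "\<dots> \<le> length \<pi> * w"
        by (intro mult_le_mono1 order.trans[OF card_mono card_length]) auto
      finally have "n ^ (k - 1) \<le> length \<pi> * w"
        using power_mono[of n "Suc n" "k - 1"] by linarith
      then have "real (n ^ (k - 1)) \<le> real (length \<pi> * w)" by (rule of_nat_mono)
      then have "real n ^ (k - 1) / real w \<le> real (length \<pi>)" using w by (simp add: field_simps)
      then show ?thesis unfolding L_def by linarith
    qed
  qed
  \<comment> \<open>This refutation is chosen for \<open>A\<close> alone, before \<open>n\<close>,
    so its length is a constant.\<close>
  moreover obtain \<pi> where \<pi>: "treelike_refutation A \<pi>" "refutation_width \<pi> \<le> k + 1"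
    using deriv_treelike[OF yesA] by blast
  have "treelike_refutation (\<Gamma> n) \<pi>" for n
  proof -
    have "justifies (\<Gamma> n) \<pi> J" if "justifies A \<pi> J" for J
      using that by (fastforce simp: justifies_def \<Gamma>_def split: option.splits)
    moreover have "refutation (\<Gamma> n) \<pi>"
      using \<pi>(1) by (auto simp: treelike_refutation_def refutation_def \<Gamma>_def)
    ultimately show ?thesis using \<pi>(1) unfolding treelike_refutation_def by blast
  qed
  then have "\<exists>U :: nat \<Rightarrow> nat. (\<lambda>n. real (U n)) \<in> O(\<lambda>n. 1) \<and>
        (\<forall>n\<ge>1. \<exists>\<pi>. treelike_refutation (\<Gamma> n) \<pi> \<and> refutation_width \<pi> \<le> k + 1 \<and>
           length \<pi> \<le> U n)"
    using \<pi>(2) by (intro exI[of _ "\<lambda>_. length \<pi>"]) auto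
  ultimately show ?thesis
    by (intro exI[of _ \<Gamma>] conjI; (assumption | simp))
qed

end
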